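(* Let $\ell\ge 1$ be an integer and let $\alpha_s=\alpha_s^{(\ell,1)}(1,q)$ be defined by $\alpha_0=1$, $$\alpha_{3r}=q^{\frac32(\ell-3)r^2-\frac12(\ell-3)r}+q^{\frac32(\ell-3)r^2+\frac12(\ell-3)r}\quad(r\ge 1),$$ $$\alpha_{3r+1}=-q^{\frac32(\ell-3)r^2+\frac12(\ell-3)r}\quad(r\ge 0),\qquad \alpha_{3r-1}=-q^{\frac32(\ell-3)r^2-\frac12(\ell-3)r}\quad(r\ge 1).$$ Let $\beta_n^{(\ell,1)}(1,q)=\sum_{s=0}^n\frac{\alpha_s}{(q;q)_{n-s}(q;q)_{n+s}}$ for integers $n\ge 0$. Then for every integer $n\ge 0$, $$\beta_n^{(\ell,1)}(1,q)=\frac{q^n}{(q;q)_n(q^2;q)_n}\sum_{r\in\mathbb Z}\frac{(1-q^{6r+1})\,(q^{-n};q)_{3r}}{(1-q)\,(q^{n+2};q)_{3r}}(-1)^r q^{\frac32(\ell-6)r^2+\frac12(\ell-6)r+3nr}.$$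
   Context: $q$ is a formal variable; the identity is between rational functions of $q$. For an integer $k\ge 0$, $(a;q)_k=\prod_{j=0}^{k-1}(1-aq^j)$ and $(a;q)_{-k}=1/\prod_{j=1}^{k}(1-aq^{-j})$. For $r<0$, $1/(q^{n+2};q)_{3r}$ means $\prod_{j=1}^{-3r}(1-q^{n+2-j})$. All but finitely many terms of the bilateral sum vanish. *)

theory Defs
  imports "HOL-Computational_Algebra.Polynomial_Factorial" "HOL-Library.Groups_Big_Fun"
begin

text \<open>The formal variable \<open>q\<close> of the field \<open>K(q)\<close> of rational functions over \<open>K\<close>.\<close>

definition qvar :: "'a::field_char_0 poly fract" where
  "qvar = to_fract [:0, 1:]"

lemma qvar_nonzero: "qvar \<noteq> 0"
  by (simp add: qvar_def)

definition qpoch :: "'b::field \<Rightarrow> 'b \<Rightarrow> int \<Rightarrow> 'b" where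
  "qpoch a q k = (if k \<ge> 0 then (\<Prod>j<nat k. 1 - a * q ^ j)
                  else 1 / (\<Prod>j=1..nat (- k). 1 - a * q powi (- int j)))"

text \<open>The quotient \<open>1 / (a;q)\<^sub>k\<close>. For \<open>k < 0\<close> it is by convention the finite
  product below, which may vanish, namely where \<open>(a;q)\<^sub>k\<close> has a pole.\<close>

definition qpoch_recip :: "'b::field \<Rightarrow> 'b \<Rightarrow> int \<Rightarrow> 'b" where
  "qpoch_recip a q k = (if k \<ge> 0 then 1 / qpoch a q k
                        else (\<Prod>j=1..nat (- k). 1 - a * q powi (- int j)))"

text \<open>All divisions of exponents by 2 below and in the theorem are exact.\<close>

lemma even_exponent: "even (3 * c * r\<^sup>2 - c * r)" "even (3 * c * r\<^sup>2 + c * r)" for c r :: int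
  by simp_all

definition alpha :: "int \<Rightarrow> 'b::field \<Rightarrow> nat \<Rightarrow> 'b" where
  "alpha l q s =
    (if s = 0 then 1
     else if s mod 3 = 0 then
       (let r = int (s div 3) in
          q powi ((3 * (l - 3) * r\<^sup>2 - (l - 3) * r) div 2)
          + q powi ((3 * (l - 3) * r\<^sup>2 + (l - 3) * r) div 2))
     else if s mod 3 = 1 then
       (let r = int (s div 3) in - (q powi ((3 * (l - 3) * r\<^sup>2 + (l - 3) * r) div 2)))
     else
       (let r = int (s div 3) + 1 in - (q powi ((3 * (l - 3) * r\<^sup>2 - (l - 3) * r) div 2))))"

lemma alpha_0: "alpha l q 0 = 1"
  by (simp add: alpha_def)

lemma alpha_3r:
  "r \<ge> 1 \<Longrightarrow> alpha l q (3 * r) =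
     q powi ((3 * (l - 3) * (int r)\<^sup>2 - (l - 3) * int r) div 2)
     + q powi ((3 * (l - 3) * (int r)\<^sup>2 + (l - 3) * int r) div 2)"
  by (simp add: alpha_def Let_def)

lemma alpha_3r_plus_1:
  "alpha l q (3 * r + 1) = - (q powi ((3 * (l - 3) * (int r)\<^sup>2 + (l - 3) * int r) div 2))"
proof -
  have "(3 * r + 1) mod 3 = 1" "(3 * r + 1) div 3 = r" by simp_all
  then show ?thesis by (simp add: alpha_def Let_def)
qed

lemma alpha_3r_minus_1:
  assumes "r \<ge> 1"
  shows "alpha l q (3 * r - 1) = - (q powi ((3 * (l - 3) * (int r)\<^sup>2 - (l - 3) * int r) div 2))"
proof -
  obtain t where r: "r = Suc t" using assms by (cases r) auto
  then have "3 * r - 1 = 3 * t + 2" by simp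
  moreover have "(3 * t + 2) mod 3 = 2" by (simp only: mod_mult_self4) simp
  moreover have "(3 * t + 2) div 3 = t" by simp
  moreover have "int t + 1 = int r" using r by simp
  ultimately show ?thesis by (simp add: alpha_def Let_def)
qed

definition beta :: "int \<Rightarrow> 'b::field \<Rightarrow> nat \<Rightarrow> 'b" where
  "beta l q n = (\<Sum>s=0..n. alpha l q s / (qpoch q q (int n - int s) * qpoch q q (int n + int s)))"

text \<open>\<^const>\<open>Sum_any\<close> is zero by default on functions of infinite support. The following
  factors occur in every term of the bilateral sum in the theorem, so its support is finite.\<close>

lemma finite_bilateral_support:
  fixes q :: "'b::field"
  assumes "q \<noteq> 0"
  shows "finite {r. qpoch (q powi (- int n)) q (3 * r) * qpoch_recip (q ^ (n + 2)) q (3 * r) \<noteq> 0}"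
    (is "finite ?S")
proof (rule finite_subset)
  show "?S \<subseteq> {- int (n + 2)..int n}"
  proof (rule subsetI, rule ccontr)
    fix r assume r: "r \<in> ?S" and "r \<notin> {- int (n + 2)..int n}"
    then consider "r > int n" | "r < - int (n + 2)" by fastforce
    then show False
    proof cases
      case 1
      then have "n \<in> {..<nat (3 * r)}" by auto
      moreover have "1 - q powi (- int n) * q ^ n = 0"
        using assms by (simp add: power_int_minus)
      ultimately have "qpoch (q powi (- int n)) q (3 * r) = 0"
        using 1 unfolding qpoch_def by (auto intro!: prod_zero)
      with r show False by simp
    next
      case 2
      then have "n + 2 \<in> {1..nat (- (3 * r))}" by auto
      moreover have "1 - q ^ (n + 2) * q powi (- int (n + 2)) = 0"
        unfolding power_int_minus power_int_of_nat right_inverse[OF power_not_zero[OF assms]] by (rule diff_self)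
      ultimately have "(\<Prod>j=1..nat (- (3 * r)). 1 - q ^ (n + 2) * q powi (- int j)) = 0"
        by (intro prod_zero) blast+
      then have "qpoch_recip (q ^ (n + 2)) q (3 * r) = 0"
        using 2 unfolding qpoch_recip_def by simp
      with r show False by simp
    qed
  qed
qed simp

end

theory Submission
  imports Defs
begin

text \<open>With \<open>e(r) = (3(l - 3)r\<^sup>2 + (l - 3)r) / 2\<close> one has \<open>\<alpha>\<^sub>s = c(s) + c(-s)\<close> for \<open>s > 0\<close>, where
  \<open>c(3r) = q^e(r)\<close>, \<open>c(3r + 1) = -q^e(r)\<close> and \<open>c(3r + 2) = 0\<close> for all integers \<open>r\<close>. Hence the left-hand
  side is the bilateral sum over \<open>r\<close> of \<open>q^e(r)\<close> times
  \<open>1/((q)\<^sub>n\<^sub>-\<^sub>3\<^sub>r (q)\<^sub>n\<^sub>+\<^sub>3\<^sub>r) - 1/((q)\<^sub>n\<^sub>-\<^sub>3\<^sub>r\<^sub>-\<^sub>1 (q)\<^sub>n\<^sub>+\<^sub>3\<^sub>r\<^sub>+\<^sub>1)\<close>, and this difference equals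
  \<open>q^(n - 3r) (1 - q^(6r + 1)) / ((q)\<^sub>n\<^sub>-\<^sub>3\<^sub>r (q)\<^sub>n\<^sub>+\<^sub>3\<^sub>r\<^sub>+\<^sub>1)\<close>, which is the summand on the right.\<close>

text \<open>The extension by zero makes the recurrence \<open>inv_qfact_pred\<close> hold for all integers.\<close>

definition inv_qfact :: "'b::field \<Rightarrow> int \<Rightarrow> 'b" where
  "inv_qfact q k = (if k < 0 then 0 else 1 / qpoch q q k)"

lemma inv_qfact_nonneg: "k \<ge> 0 \<Longrightarrow> inv_qfact q k = 1 / qpoch q q k"
  by (simp add: inv_qfact_def)

lemma inv_qfact_neg: "k < 0 \<Longrightarrow> inv_qfact q k = 0"
  by (simp add: inv_qfact_def)

section \<open>Recurrences for q-shifted factorials in the index\<close>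

lemma qpoch_0 [simp]: "qpoch a q 0 = 1"
  by (simp add: qpoch_def)

lemma qpoch_recip_0 [simp]: "qpoch_recip a q 0 = 1"
  by (simp add: qpoch_recip_def)

lemma qpoch_Suc: "k \<ge> 0 \<Longrightarrow> qpoch a q (k + 1) = qpoch a q k * (1 - a * q powi k)"
  by (simp add: qpoch_def nat_add_distrib power_int_def)

text \<open>At negative index \<open>qpoch\<close> and \<open>qpoch_recip\<close> are built from the
  same product; a general \<open>f\<close> serves both.\<close>

lemma prod_nat_neg_step:
  "k \<le> 0 \<Longrightarrow> (\<Prod>j=1..nat (- (k - 1)). f (- int j)) = (\<Prod>j=1..nat (- k). f (- int j)) * f (k - 1)"
  for f :: "int \<Rightarrow> 'b::comm_monoid_mult"
proof -
  assume "k \<le> 0"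
  then have "nat (- (k - 1)) = Suc (nat (- k))" "- int (Suc (nat (- k))) = k - 1" by simp_all
  then show ?thesis by (simp only: prod.cl_ivl_Suc) simp
qed

lemma qpoch_recip_pred:
  "k \<le> 0 \<Longrightarrow> qpoch_recip a q (k - 1) = qpoch_recip a q k * (1 - a * q powi (k - 1))"
  using prod_nat_neg_step[of k "\<lambda>i. 1 - a * q powi i"]
  by (cases "k = 0") (simp_all add: qpoch_recip_def)

lemma qpoch_pred:
  "k \<le> 0 \<Longrightarrow> qpoch a q (k - 1) = qpoch a q k / (1 - a * q powi (k - 1))"
  using prod_nat_neg_step[of k "\<lambda>i. 1 - a * q powi i"]
  by (cases "k = 0") (simp_all add: qpoch_def)

lemma qpoch_recip_Suc:
  "k \<ge> 0 \<Longrightarrow> qpoch_recip a q (k + 1) = qpoch_recip a q k / (1 - a * q powi k)"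
  by (simp add: qpoch_recip_def qpoch_Suc)

lemma qpoch_shift:
  assumes "k \<ge> 0"
  shows "qpoch a q (k + 1) = (1 - a) * qpoch (a * q) q k"
proof -
  have "nat (k + 1) = Suc (nat k)" using assms by simp
  then show ?thesis using assms
    by (simp add: qpoch_def prod.lessThan_Suc_shift mult.assoc del: prod.lessThan_Suc)
qed

lemma triangle_Suc: "(k + 1) * (k + 1 - 1) div 2 = k * (k - 1) div 2 + k" for k :: int
proof -
  have "(k + 1) * (k + 1 - 1) = k * (k - 1) + k * 2" by (simp add: algebra_simps)
  then show ?thesis by simp
qed

section \<open>Closed forms through inverse q-factorials, for q not a root of unity\<close>

locale q_nonroot =
  fixes q :: "'b::field"
  assumes q_nz: "q \<noteq> 0" and q_pow_ne: "k > 0 \<Longrightarrow> q ^ k \<noteq> 1"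
begin

lemma q_powi_eq_1_iff: "q powi k = 1 \<longleftrightarrow> k = 0"
proof
  assume *: "q powi k = 1"
  show "k = 0"
  proof (rule ccontr)
    assume "k \<noteq> 0"
    then have "q ^ nat \<bar>k\<bar> \<noteq> 1" using q_pow_ne[of "nat \<bar>k\<bar>"] by simp
    moreover have "q ^ nat \<bar>k\<bar> = 1"
      using * by (cases "k \<ge> 0") (auto simp: power_int_def power_inverse)
    ultimately show False by simp
  qed
qed simp

lemma qpoch_q_nz: "qpoch q q k \<noteq> 0" if "k \<ge> 0"
proof -
  have "1 - q * q ^ j \<noteq> 0" for j using q_pow_ne[of "Suc j"] by simp
  then show ?thesis using that by (simp add: qpoch_def)
qed

lemma inv_qfact_pred: "inv_qfact q (k - 1) = (1 - q powi k) * inv_qfact q k"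
proof (cases "k > 0")
  case True
  have "qpoch q q k = qpoch q q (k - 1) * (1 - q powi k)"
    using qpoch_Suc[of "k - 1" q q] True q_nz
    by (simp add: power_int_diff)
  moreover have "1 - q powi k \<noteq> 0" using q_powi_eq_1_iff[of k] True by simp
  ultimately show ?thesis
    using True by (simp add: inv_qfact_nonneg)
next
  \<comment> \<open>At \<open>k = 0\<close> the factor 1 - q^0 vanishes, in agreement with the
    extension by zero.\<close>
  case False
  then show ?thesis by (cases "k = 0") (simp_all add: inv_qfact_neg)
qed

text \<open>Both sides equal 1 at \<open>k = 0\<close> and gain the factor 1 - q^(k - n) from k to k
  + 1, so induction runs in both directions from 0. For k > n both sides vanish.\<close>

lemma qpoch_powi_neg:
  "qpoch (q powi (- int n)) q k =
    (-1) powi k * q powi (k * (k - 1) div 2 - int n * k) * qpoch q q (int n) * inv_qfact q (int n - k)"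
  (is "?L k = ?R k")
proof -
  have R: "?R (k + 1) = ?R k * (1 - q powi (k - int n))" for k
  proof -
    have e: "(k + 1) * (k + 1 - 1) div 2 - int n * (k + 1)
        = k * (k - 1) div 2 - int n * k + (k - int n)"
      unfolding triangle_Suc by (simp add: algebra_simps)
    have i: "inv_qfact q (int n - (k + 1)) = (1 - q powi (int n - k)) * inv_qfact q (int n - k)"
      using inv_qfact_pred[of "int n - k"] by (simp add: algebra_simps)
    \<comment> \<open>Reversing the exponent in each factor is the source of the sign and of the
      power of q.\<close>
    have s: "q powi (k - int n) * (1 - q powi (int n - k)) = - (1 - q powi (k - int n))"
      using q_nz by (simp add: algebra_simps flip: power_int_add)
    have "?R (k + 1) = - ((-1) powi k * q powi (k * (k - 1) div 2 - int n * k)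
        * qpoch q q (int n) * inv_qfact q (int n - k))
        * (q powi (k - int n) * (1 - q powi (int n - k)))"
      unfolding e i power_int_add[OF disjI1[OF q_nz]] by (simp add: power_int_add mult_ac)
    then show ?thesis unfolding s by (simp add: algebra_simps)
  qed
  have a: "q powi (- int n) * q powi k = q powi (k - int n)" for k
    using q_nz by (simp add: power_int_diff power_int_minus field_simps)
  show ?thesis
  proof (induction k rule: int_induct[where k = 0])
    case base
    show ?case using qpoch_q_nz[of "int n"] by (simp add: inv_qfact_nonneg)
  next
    case (step1 i)
    then show ?case unfolding R by (simp add: qpoch_Suc a)
  next
    case (step2 i)
    \<comment> \<open>Going down, the recurrence must be inverted; here i \<le> 0 keeps the exponent
      negative. The zero factor at k = n is met only going up, where nothing is divided.\<close>
    have "1 - q powi (i - 1 - int n) \<noteq> 0"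
      using q_powi_eq_1_iff[of "i - 1 - int n"] step2 by simp
    then have "?R (i - 1 + 1) / (1 - q powi (i - 1 - int n)) = ?R (i - 1)"
      unfolding R[of "i - 1"] by (rule nonzero_mult_div_cancel_right)
    then show ?case using step2 by (simp only: qpoch_pred a diff_add_cancel)
  qed
qed

text \<open>For k \<ge> 0 this is (q)_(n+1) / (q)_(n+1+k). For k \<le> -(n + 2) the left product
  contains 1 - q^0, and \<open>inv_qfact\<close> is zero on the right.\<close>

lemma qpoch_recip_power:
  "qpoch_recip (q ^ (n + 2)) q k = qpoch q q (int n + 1) * inv_qfact q (int n + 1 + k)"
  (is "?L k = ?R k")
proof -
  have R: "?R k = ?R (k + 1) * (1 - q powi (int n + 2 + k))" for k
  proof -
    have "int n + 2 + k - 1 = int n + 1 + k" "int n + 1 + (k + 1) = int n + 2 + k" by simp_all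
    then show ?thesis using inv_qfact_pred[of "int n + 2 + k"] by (simp only: mult_ac)
  qed
  have a: "q ^ (n + 2) * q powi k = q powi (int n + 2 + k)" for k
    using q_nz by (simp add: power_int_add power2_eq_square mult_ac)
  show ?thesis
  proof (induction k rule: int_induct[where k = 0])
    case base
    show ?case using qpoch_q_nz[of "int n + 1"] by (simp add: inv_qfact_nonneg)
  next
    case (step1 i)
    have "1 - q powi (int n + 2 + i) \<noteq> 0"
      using q_powi_eq_1_iff[of "int n + 2 + i"] step1 by simp
    then have "?R i / (1 - q powi (int n + 2 + i)) = ?R (i + 1)"
      unfolding R[of i] by (rule nonzero_mult_div_cancel_right)
    then show ?case using step1 by (simp only: qpoch_recip_Suc a)
  next
    case (step2 i)
    then show ?case using R[of "i - 1"] by (simp only: qpoch_recip_pred a) simp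
  qed
qed

end

section \<open>Unfolding the sum over s into a bilateral sum\<close>

lemma sum_symmetric_interval:
  "(\<Sum>m\<in>{- int n..int n}. g m) = g 0 + (\<Sum>s=1..n. g (int s) + g (- int s))"
  for g :: "int \<Rightarrow> 'b::comm_monoid_add"
proof (induction n)
  case (Suc n)
  have "{- int (Suc n)..int (Suc n)} = insert (int (Suc n)) (insert (- int (Suc n)) {- int n..int n})"
    by auto
  then show ?case using Suc.IH by (simp add: ac_simps)
qed simp

lemma sum_by_residues_mod_3:
  "(\<Sum>m\<in>{- 3 * N..3 * N + 2}. g m) = (\<Sum>r\<in>{- N..N}. g (3 * r) + g (3 * r + 1) + g (3 * r + 2))"
  for g :: "int \<Rightarrow> 'b::comm_monoid_add" and N :: int
proof -
  have "(\<Sum>m\<in>{- 3 * N..3 * N + 2}. g m) = (\<Sum>(r, i)\<in>{- N..N} \<times> {0, 1, 2}. g (3 * r + i))"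
    by (rule sum.reindex_bij_witness[where i = "\<lambda>(r, i). 3 * r + i" and j = "\<lambda>m. (m div 3, m mod 3)"])
       auto
  also have "\<dots> = (\<Sum>r\<in>{- N..N}. \<Sum>i\<in>{0, 1, 2}. g (3 * r + i))"
    by (rule sum.cartesian_product[symmetric])
  finally show ?thesis by (simp add: add.assoc)
qed

text \<open>For \<open>c = 1\<close> these are the generalized pentagonal numbers. The two sides of
  the identity use \<open>c = l - 3\<close> and \<open>c = l - 6\<close>.\<close>

definition pent :: "int \<Rightarrow> int \<Rightarrow> int" where
  "pent c r = (3 * c * r\<^sup>2 + c * r) div 2"

lemma two_pent: "2 * pent c r = 3 * c * r\<^sup>2 + c * r"
  unfolding pent_def using even_exponent(2)[of c r] by (rule dvd_mult_div_cancel)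

text \<open>The function c of the overview. Since \<open>div\<close> rounds down, negative arguments
  obey the same formula.\<close>

definition half_alpha :: "int \<Rightarrow> 'b::field \<Rightarrow> int \<Rightarrow> 'b" where
  "half_alpha l q m = (if m mod 3 = 0 then q powi pent (l - 3) (m div 3)
     else if m mod 3 = 1 then - (q powi pent (l - 3) (m div 3)) else 0)"

lemma half_alpha_simps:
  "half_alpha l q (3 * r) = q powi pent (l - 3) r"
  "half_alpha l q (3 * r + 1) = - (q powi pent (l - 3) r)"
  "half_alpha l q (3 * r + 2) = 0"
proof -
  have "(3 * r + 1) mod 3 = 1" "(3 * r + 1) div 3 = r" "(3 * r + 2) mod 3 = 2" by presburger+
  then show "half_alpha l q (3 * r) = q powi pent (l - 3) r"
    "half_alpha l q (3 * r + 1) = - (q powi pent (l - 3) r)"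
    "half_alpha l q (3 * r + 2) = 0"
    by (simp_all add: half_alpha_def)
qed

text \<open>If 3 divides s, both halves contribute; otherwise exactly one of s and -s has residue 2
  and drops out. At s = 0 the value 1 would be counted twice.\<close>

lemma alpha_eq_half_alpha:
  assumes "s \<ge> 1"
  shows "alpha l q s = half_alpha l q (int s) + half_alpha l q (- int s)"
proof -
  have "s = 3 * (s div 3) \<or> s = 3 * (s div 3) + 1 \<or> s = 3 * (s div 3 + 1) - 1"
    by presburger
  then consider r where "r \<ge> 1" "s = 3 * r" | r where "s = 3 * r + 1" | r where "r \<ge> 1" "s = 3 * r - 1"
    using assms by force
  then show ?thesis
  proof cases
    case (1 r)
    then show ?thesis
      using half_alpha_simps(1)[of l q "int r"] half_alpha_simps(1)[of l q "- int r"]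
      by (simp add: alpha_3r pent_def)
  next
    case (2 r)
    then have i: "int s = 3 * int r + 1" "- int s = 3 * (- int r - 1) + 2" by simp_all
    show ?thesis
      unfolding i(2) unfolding i(1) half_alpha_simps unfolding 2 alpha_3r_plus_1 by (simp add: pent_def)
  next
    case (3 r)
    then have i: "int s = 3 * (int r - 1) + 2" "- int s = 3 * (- int r) + 1" by simp_all
    show ?thesis
      unfolding i(2) unfolding i(1) half_alpha_simps unfolding 3(2) alpha_3r_minus_1[OF 3(1)] by (simp add: pent_def)
  qed
qed

section \<open>Termwise comparison of the two bilateral sums\<close>

context q_nonroot
begin

lemma beta_bilateral:
  assumes "N \<ge> int n"
  shows "beta l q n = (\<Sum>r\<in>{- N..N}. q powi pent (l - 3) r *
    (inv_qfact q (int n - 3 * r) * inv_qfact q (int n + 3 * r)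
     - inv_qfact q (int n - 3 * r - 1) * inv_qfact q (int n + 3 * r + 1)))"
proof -
  define g where "g m = half_alpha l q m * (inv_qfact q (int n - m) * inv_qfact q (int n + m))" for m
  have g0: "g 0 = alpha l q 0 / (qpoch q q (int n - int 0) * qpoch q q (int n + int 0))"
    using half_alpha_simps(1)[of l q 0] by (simp add: g_def alpha_0 pent_def inv_qfact_nonneg)
  have gs: "alpha l q s / (qpoch q q (int n - int s) * qpoch q q (int n + int s)) = g (int s) + g (- int s)"
    if "s \<in> {1..n}" for s
    using that
    by (simp add: g_def alpha_eq_half_alpha inv_qfact_nonneg add_divide_distrib mult.commute)
  have "beta l q n = g 0 + (\<Sum>s=1..n. g (int s) + g (- int s))"
    unfolding beta_def g0 sum.atLeast_Suc_atMost[OF le0] by (simp add: gs)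
  also have "\<dots> = (\<Sum>m\<in>{- int n..int n}. g m)"
    by (rule sum_symmetric_interval[symmetric])
  \<comment> \<open>The new terms have |m| > n, so one inverse factorial is zero; the upper end
    completes the last block of three residues.\<close>
  also have "\<dots> = (\<Sum>m\<in>{- 3 * N..3 * N + 2}. g m)"
    using assms by (intro sum.mono_neutral_left) (auto simp: g_def inv_qfact_def)
  also have "\<dots> = (\<Sum>r\<in>{- N..N}. g (3 * r) + g (3 * r + 1) + g (3 * r + 2))"
    by (rule sum_by_residues_mod_3)
  finally show ?thesis
    by (simp add: g_def half_alpha_simps right_diff_distrib diff_diff_eq add.assoc)
qed

text \<open>Over the common factor on the right, \<open>inv_qfact_pred\<close> turns the difference
  into (1 - q^(a+b+1)) - (1 - q^(a-b)) = q^(a-b) (1 - q^(2b+1)).\<close>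

lemma inv_qfact_product_diff:
  "inv_qfact q (a - b) * inv_qfact q (a + b) - inv_qfact q (a - b - 1) * inv_qfact q (a + b + 1)
   = q powi (a - b) * (1 - q powi (2 * b + 1)) * (inv_qfact q (a - b) * inv_qfact q (a + b + 1))"
proof -
  have "q powi (a + b + 1) = q powi (a - b) * q powi (2 * b + 1)"
    using q_nz by (simp add: add_ac flip: power_int_add)
  then show ?thesis
    using inv_qfact_pred[of "a + b + 1"] by (simp add: inv_qfact_pred[of "a - b"]) (simp add: algebra_simps)
qed

lemma bilateral_summand:
  "q ^ n / (qpoch q q (int n) * qpoch (q\<^sup>2) q (int n)) *
     ((1 - q powi (6 * r + 1)) * qpoch (q powi (- int n)) q (3 * r) / (1 - q)
      * qpoch_recip (q ^ (n + 2)) q (3 * r)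
      * (-1) powi r * q powi ((3 * (l - 6) * r\<^sup>2 + (l - 6) * r) div 2 + 3 * int n * r))
   = q powi pent (l - 3) r *
      (inv_qfact q (int n - 3 * r) * inv_qfact q (int n + 3 * r)
       - inv_qfact q (int n - 3 * r - 1) * inv_qfact q (int n + 3 * r + 1))"
proof -
  have q2: "qpoch (q\<^sup>2) q (int n) = qpoch q q (int n + 1) / (1 - q)"
    using qpoch_shift[of "int n" q q] q_pow_ne[of 1] by (simp add: power2_eq_square)
  have sign: "(-1) powi (3 * r) * (-1) powi r = (1 :: 'b)"
    by (simp flip: power_int_add)
  \<comment> \<open>Exponents are compared after doubling. The triangular number of 3r comes from
    \<open>qpoch_powi_neg\<close> and accounts for the passage from l - 6 to l - 3.\<close>
  have "2 * (3 * r * (3 * r - 1) div 2) = 3 * r * (3 * r - 1)"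
    by (rule dvd_mult_div_cancel) simp
  then have e: "3 * r * (3 * r - 1) div 2 - int n * (3 * r) + (pent (l - 6) r + 3 * int n * r) + int n
      = pent (l - 3) r + (int n - 3 * r)"
    using two_pent[of "l - 6" r] two_pent[of "l - 3" r]
    by (simp add: algebra_simps power2_eq_square)
  have "q powi (3 * r * (3 * r - 1) div 2 - int n * (3 * r)) * q powi (pent (l - 6) r + 3 * int n * r) * q ^ n
      = q powi pent (l - 3) r * q powi (int n - 3 * r)"
    using arg_cong[OF e, of "\<lambda>x. q powi x"]
    unfolding power_int_add[OF disjI1[OF q_nz]] power_int_of_nat .
  moreover have "qpoch q q (int n) \<noteq> 0" "qpoch q q (int n + 1) \<noteq> 0" "1 - q \<noteq> 0"
    using q_pow_ne[of 1] by (simp_all add: qpoch_q_nz)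
  \<comment> \<open>Here A, B, D, E, F are powers of q, P and P' are (q)_n and (q)_(n+1), c is 1 -
    q, w is q^(6r+1), s and s' are the signs, and i and j are the inverse factorials.\<close>
  moreover have "D / (P * (P' / c)) * ((1 - w) * (s * A * P * i) / c * (P' * j) * s' * B)
      = E * (F * (1 - w) * (i * j))"
    if "A * B * D = E * F" "P \<noteq> 0" "P' \<noteq> 0" "c \<noteq> 0" "s * s' = 1"
    for A B D E F P P' c w s s' i j :: 'b
  proof -
    have "D / (P * (P' / c)) * ((1 - w) * (s * A * P * i) / c * (P' * j) * s' * B)
        = (A * B * D) * (s * s') * ((1 - w) * (i * j))"
      using that(2-4) by (simp add: divide_simps)
    then show ?thesis unfolding that(1,5) by simp
  qed
  ultimately show ?thesis
    using inv_qfact_product_diff[of "int n" "3 * r"] sign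
    unfolding q2 qpoch_powi_neg qpoch_recip_power pent_def[of "l - 6", symmetric]
    by (simp add: add_ac)
qed

theorem beta_eq_bilateral_sum:
  "beta l q n =
    q ^ n / (qpoch q q (int n) * qpoch (q\<^sup>2) q (int n)) *
    Sum_any (\<lambda>r::int.
      (1 - q powi (6 * r + 1)) * qpoch (q powi (- int n)) q (3 * r) / (1 - q)
      * qpoch_recip (q ^ (n + 2)) q (3 * r)
      * (-1) powi r * q powi ((3 * (l - 6) * r\<^sup>2 + (l - 6) * r) div 2 + 3 * int n * r))"
  (is "_ = ?C * Sum_any ?f")
proof -
  \<comment> \<open>A nonzero term forces -(n + 1) \<le> 3r \<le> n. The interval is symmetric to
    fit \<open>beta_bilateral\<close> with \<open>N = n + 1\<close>.\<close>
  have "{r. ?f r \<noteq> 0} \<subseteq> {- (int n + 1)..int n + 1}"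
  proof (rule subsetI, rule ccontr)
    fix r assume "r \<in> {r. ?f r \<noteq> 0}" and r: "r \<notin> {- (int n + 1)..int n + 1}"
    then have "inv_qfact q (int n - 3 * r) \<noteq> 0" "inv_qfact q (int n + 1 + 3 * r) \<noteq> 0"
      unfolding qpoch_powi_neg qpoch_recip_power by auto
    then have "int n - 3 * r \<ge> 0" "int n + 1 + 3 * r \<ge> 0"
      by (auto simp: inv_qfact_def split: if_splits)
    with r show False by simp
  qed
  then have "Sum_any ?f = sum ?f {- (int n + 1)..int n + 1}"
    by (intro Sum_any.expand_superset) simp_all
  moreover have "int n \<le> int n + 1" by simp
  ultimately show ?thesis
    by (simp only: beta_bilateral sum_distrib_left bilateral_summand)
qed

end

section \<open>The formal variable is not a root of unity\<close>

lemma qvar_power_ne_1: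
  assumes "k > 0"
  shows "(qvar :: 'a::field_char_0 poly fract) ^ k \<noteq> 1"
proof
  have to_fract_power: "to_fract p ^ k = to_fract (p ^ k)" for p :: "'a poly"
    by (induction k) simp_all
  assume "(qvar :: 'a poly fract) ^ k = 1"
  then have "to_fract ([:0, 1:] ^ k :: 'a poly) = to_fract 1"
    by (simp add: qvar_def add: to_fract_power)
  then have "[:0, 1:] ^ k = (1 :: 'a poly)" by (simp only: to_fract_eq_iff)
  \<comment> \<open>The power of the variable has degree k > 0, a contradiction.\<close>
  then have "degree ([:0, 1:] ^ k :: 'a poly) = 0" by simp
  then show False using assms by (simp add: degree_power_eq)
qed

theorem mainTheorem1:
  fixes l :: int and n :: nat and q :: "'a::field_char_0 poly fract"
  assumes "l \<ge> 1" and "q = qvar"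
  shows "beta l q n =
    q ^ n / (qpoch q q (int n) * qpoch (q\<^sup>2) q (int n)) *
    Sum_any (\<lambda>r::int.
      (1 - q powi (6 * r + 1)) * qpoch (q powi (- int n)) q (3 * r) / (1 - q)
      * qpoch_recip (q ^ (n + 2)) q (3 * r)
      * (-1) powi r * q powi ((3 * (l - 6) * r\<^sup>2 + (l - 6) * r) div 2 + 3 * int n * r))"
proof -
  interpret q_nonroot q
    using assms(2) qvar_nonzero qvar_power_ne_1 by unfold_locales auto
  show ?thesis by (rule beta_eq_bilateral_sum)
qed

end
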